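(* Let $G=(V,E)$ be a finite, connected and symmetric weighted graph with vertex measure $\mu$, and let $h_+,h_-:V\to\mathbb{R}$ satisfy $\max_V h_+>0$ and $h_-\ge0$ on $V$. Set $$c^*_{h_+,h_-}:=\inf_{u\in L^\infty(V)}\max_V\left(\Delta u+h_+e^{u}+h_-e^{-u}\right).$$ If $\int_V h_+\,d\mu<0$ and $c^*_{h_+,h_-}<0$, then the sinh-Gordon equation $$-\Delta u=h_+e^{u}+h_-e^{-u}-c\quad\text{on }V$$ has no solutions when $c<c^*_{h_+,h_-}$, has at least one solution for $c=c^*_{h_+,h_-}$, and has at least two solutions if $c^*_{h_+,h_-}<c<0$.
   Context: A finite, connected and symmetric graph $G=(V,E)$ has a finite vertex set $V$ and symmetric edge weights $\omega_{xy}=\omega_{yx}\ge 0$ with $\omega_{xy}>0$ if and only if $x\sim y$ (i.e. $xy\in E$); connected means that any two vertices are joined by a path of edges. The vertex measure is a positive function $\mu:V\to(0,\infty)$, $x\mapsto\mu_x$. The Laplacian acting on $u:V\to\mathbb{R}$ is $$\Delta u(x)=\frac{1}{\mu_x}\sum_{y\sim x}\omega_{xy}\,(u(y)-u(x)),$$ and $\int_V f\,d\mu=\sum_{x\in V}f(x)\mu_x$. $L^\infty(V)$ is the space of all functions $V\to\mathbb{R}$. *)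

theory Defs
  imports "HOL-Analysis.Analysis"
begin

text \<open>The vertex set is the universe of a finite type, so \<open>'v \<Rightarrow> real\<close> is the space of all
  real functions on the vertices. Loops are not excluded; they do not affect the Laplacian.\<close>

locale finite_connected_weighted_graph =
  fixes E :: "'v::finite \<Rightarrow> 'v \<Rightarrow> bool"
    and \<omega> :: "'v \<Rightarrow> 'v \<Rightarrow> real"
    and \<mu> :: "'v \<Rightarrow> real"
  assumes weight_sym: "\<omega> x y = \<omega> y x"
    and weight_nonneg: "\<omega> x y \<ge> 0"
    and weight_pos_iff: "\<omega> x y > 0 \<longleftrightarrow> E x y"
    and connected: "E\<^sup>*\<^sup>* x y"
    and measure_pos: "\<mu> x > 0"

definition graph_laplacian ::
  "('v::finite \<Rightarrow> 'v \<Rightarrow> bool) \<Rightarrow> ('v \<Rightarrow> 'v \<Rightarrow> real) \<Rightarrow> ('v \<Rightarrow> real) \<Rightarrow> ('v \<Rightarrow> real) \<Rightarrow> 'v \<Rightarrow> real"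
  where "graph_laplacian E \<omega> \<mu> u x = (1 / \<mu> x) * (\<Sum>y\<in>{y. E x y}. \<omega> x y * (u y - u x))"

definition graph_integral :: "('v::finite \<Rightarrow> real) \<Rightarrow> ('v \<Rightarrow> real) \<Rightarrow> real"
  where "graph_integral \<mu> f = (\<Sum>x\<in>UNIV. f x * \<mu> x)"

definition c_star ::
  "('v::finite \<Rightarrow> 'v \<Rightarrow> bool) \<Rightarrow> ('v \<Rightarrow> 'v \<Rightarrow> real) \<Rightarrow> ('v \<Rightarrow> real) \<Rightarrow>
    ('v \<Rightarrow> real) \<Rightarrow> ('v \<Rightarrow> real) \<Rightarrow> real"
  where "c_star E \<omega> \<mu> h\<^sub>p h\<^sub>m =
    (INF u. MAX x. graph_laplacian E \<omega> \<mu> u x + h\<^sub>p x * exp (u x) + h\<^sub>m x * exp (- u x))"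

definition sinh_gordon_solution ::
  "('v::finite \<Rightarrow> 'v \<Rightarrow> bool) \<Rightarrow> ('v \<Rightarrow> 'v \<Rightarrow> real) \<Rightarrow> ('v \<Rightarrow> real) \<Rightarrow>
    ('v \<Rightarrow> real) \<Rightarrow> ('v \<Rightarrow> real) \<Rightarrow> real \<Rightarrow> ('v \<Rightarrow> real) \<Rightarrow> bool"
  where "sinh_gordon_solution E \<omega> \<mu> h\<^sub>p h\<^sub>m c u \<longleftrightarrow>
    (\<forall>x. - graph_laplacian E \<omega> \<mu> u x = h\<^sub>p x * exp (u x) + h\<^sub>m x * exp (- u x) - c)"

text \<open>The infimum of a set of reals is unspecified when the set is not bounded below. The following
  fact shows that this does not happen for \<^const>\<open>c_star\<close>.\<close>

lemma (in finite_connected_weighted_graph) bdd_below_c_star: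
  fixes h\<^sub>p h\<^sub>m :: "'v \<Rightarrow> real"
  assumes pos: "(MAX x. h\<^sub>p x) > 0" and nonneg: "\<And>x. h\<^sub>m x \<ge> 0"
  shows "bdd_below (range (\<lambda>u. MAX x. graph_laplacian E \<omega> \<mu> u x
    + h\<^sub>p x * exp (u x) + h\<^sub>m x * exp (- u x)))"
proof -
  obtain a where a: "h\<^sub>p a > 0"
    using pos by (metis (mono_tags, lifting) Max_in UNIV_not_empty finite finite_imageI image_iff image_is_empty)
  define D where "D = (1 / \<mu> a) * (\<Sum>y\<in>{y. E a y}. \<omega> a y)"
  define H where "H = 1 + (\<Sum>x\<in>UNIV. \<bar>h\<^sub>p x\<bar>)"
  define K where "K = H + D\<^sup>2 / (2 * h\<^sub>p a)"
  have D0: "D \<ge> 0"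
    unfolding D_def using measure_pos[of a] by (intro mult_nonneg_nonneg sum_nonneg weight_nonneg) simp
  have H0: "H > 0"
    unfolding H_def by (intro add_pos_nonneg sum_nonneg) simp_all
  have Hb: "- h\<^sub>p x \<le> H" for x
  proof -
    have "\<bar>h\<^sub>p x\<bar> \<le> (\<Sum>x\<in>UNIV. \<bar>h\<^sub>p x\<bar>)"
      by (rule member_le_sum) simp_all
    then show ?thesis
      unfolding H_def by linarith
  qed
  have KH: "K \<ge> H"
    unfolding K_def using a by simp
  show ?thesis
  proof (rule bdd_belowI2[where m = "- K"], rule ccontr)
    fix u :: "'v \<Rightarrow> real"
    let ?F = "\<lambda>x. graph_laplacian E \<omega> \<mu> u x + h\<^sub>p x * exp (u x) + h\<^sub>m x * exp (- u x)"
    assume "\<not> - K \<le> (MAX x. ?F x)"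
    then have F: "?F x < - K" for x
      by (simp add: not_le)
    have F': "graph_laplacian E \<omega> \<mu> u x + h\<^sub>p x * exp (u x) < - K" for x
      using F[of x] mult_nonneg_nonneg[OF nonneg[of x], of "exp (- u x)"] by simp
    obtain z where z: "u z \<le> u y" for y
      using ex_min_if_finite[of "range u"] by (auto simp: not_less)
    have "graph_laplacian E \<omega> \<mu> u z \<ge> 0"
      unfolding graph_laplacian_def using measure_pos[of z] z
      by (intro mult_nonneg_nonneg sum_nonneg weight_nonneg) simp_all
    then have "K < - h\<^sub>p z * exp (u z)"
      using F'[of z] by simp
    also have "\<dots> \<le> H * exp (u z)"
      by (rule mult_right_mono[OF Hb]) simp
    finally have "H * 1 < H * exp (u z)"
      using KH by simp
    then have uz: "u z > 0"
      using H0 by (simp only: mult_less_cancel_left_pos one_less_exp_iff)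
    then have ua: "u a > 0"
      using z[of a] by simp
    have "D * (- u a) = (1 / \<mu> a) * (\<Sum>y\<in>{y. E a y}. \<omega> a y * (- u a))"
      unfolding D_def by (simp add: sum_distrib_right sum_negf)
    also have "\<dots> \<le> graph_laplacian E \<omega> \<mu> u a"
    proof -
      have "u y \<ge> 0" for y
        using uz z[of y] by simp
      then show ?thesis
        unfolding graph_laplacian_def using measure_pos[of a]
        by (intro mult_left_mono sum_mono weight_nonneg) simp_all
    qed
    finally have 1: "h\<^sub>p a * exp (u a) < D * u a - K"
      using F'[of a] by simp
    have "(u a)\<^sup>2 / 2 \<le> exp (u a)"
      using exp_lower_Taylor_quadratic[of "u a"] ua by simp
    then have "h\<^sub>p a * ((u a)\<^sup>2 / 2) < D * u a - K"
      using 1 a by (meson le_less_trans less_imp_le mult_left_mono)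
    then have "h\<^sub>p a * ((u a)\<^sup>2 / 2) - D * u a + D\<^sup>2 / (2 * h\<^sub>p a) < 0"
      unfolding K_def using H0 by simp
    moreover have "h\<^sub>p a * ((u a)\<^sup>2 / 2) - D * u a + D\<^sup>2 / (2 * h\<^sub>p a)
      = (h\<^sub>p a * u a - D)\<^sup>2 / (2 * h\<^sub>p a)"
      using a by (simp add: field_simps power2_eq_square)
    ultimately show False
      using a by (simp add: divide_less_0_iff)
  qed
qed

end

theory Submission
  imports Defs
begin

text \<open>Let \<open>F u = \<Delta>u + h\<^sub>p e\<^sup>u + h\<^sub>m e\<^sup>-\<^sup>u\<close> and fix \<open>c < 0\<close>. Writing \<open>c - F u\<close> as the difference of
  an increasing diagonal map \<open>\<Phi>\<close> and an order preserving map \<open>R\<close>, the solutions are the fixed points of the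
  continuous, order preserving map \<open>T = \<Phi>\<^sup>-\<^sup>1 \<circ> R\<close>, and iterating \<open>T\<close> decreases the energy \<open>J\<close>.
  A small constant \<open>\<sigma>\<close> is a subsolution below all supersolutions \<open>F u \<le> c\<close>, so iterating \<open>T\<close> on a
  supersolution converges to a solution below it. The set of supersolutions is compact: they are
  bounded below by \<open>\<sigma>\<close>, bounded above at a vertex \<open>a\<close> with \<open>h\<^sub>p a > 0\<close>, and an upper bound at a
  vertex yields one at its neighbours. So the infimum defining \<open>c\<^sup>*\<close> is attained, by a supersolution
  for \<open>c = c\<^sup>*\<close>.

  If \<open>c > c\<^sup>*\<close> there is a strict supersolution \<open>w\<close>, and one solution lies below \<open>w\<close>. The iterates
  of \<open>w + t\<close> eventually drop below \<open>w\<close> for \<open>t = 0\<close> but not for large \<open>t\<close>. At the threshold value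
  of \<open>t\<close> the orbit never drops below \<open>w\<close>, yet it stays bounded, and because of the energy each of
  its limit points is a solution. This is the second one.\<close>

locale sinh_gordon = finite_connected_weighted_graph E \<omega> \<mu>
  for E :: "'v::finite \<Rightarrow> 'v \<Rightarrow> bool" and \<omega> \<mu> +
  fixes h\<^sub>p h\<^sub>m :: "'v \<Rightarrow> real" and a :: 'v and c :: real
  assumes hp_pos: "h\<^sub>p a > 0"
    and hm_nonneg: "h\<^sub>m x \<ge> 0"
    and c_neg: "c < 0"
begin

section \<open>The equation as a fixed point problem for a monotone map\<close>

definition F :: "('v \<Rightarrow> real) \<Rightarrow> 'v \<Rightarrow> real"
  where "F u x = graph_laplacian E \<omega> \<mu> u x + h\<^sub>p x * exp (u x) + h\<^sub>m x * exp (- u x)"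

definition deg :: "'v \<Rightarrow> real"
  where "deg x = (\<Sum>y\<in>UNIV. \<omega> x y) / \<mu> x"

text \<open>Splitting \<open>h\<^sub>p\<close> into positive and negative parts puts each
  exponential on the side where it is increasing. The summand \<open>s\<close>, balanced by
  \<open>u x\<close> in \<open>R\<close>, gives slope at least 1.\<close>

definition \<Phi> :: "'v \<Rightarrow> real \<Rightarrow> real"
  where "\<Phi> x s = (1 + deg x) * s + max 0 (- h\<^sub>p x) * exp s - h\<^sub>m x * exp (- s)"

definition R :: "('v \<Rightarrow> real) \<Rightarrow> 'v \<Rightarrow> real"
  where "R u x = u x + (\<Sum>y\<in>UNIV. \<omega> x y * u y) / \<mu> x + max 0 (h\<^sub>p x) * exp (u x) - c"

definition T :: "('v \<Rightarrow> real) \<Rightarrow> 'v \<Rightarrow> real"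
  where "T u x = inv (\<Phi> x) (R u x)"

text \<open>The energy of the equation: by symmetry of \<open>\<omega>\<close>, its partial
  derivative in \<open>u x\<close> is \<open>\<mu> x * (c - F u x)\<close>.\<close>

definition J :: "('v \<Rightarrow> real) \<Rightarrow> real"
  where "J u = (\<Sum>x\<in>UNIV. \<mu> x * (deg x * (u x)\<^sup>2 / 2 - h\<^sub>p x * exp (u x) + h\<^sub>m x * exp (- u x) + c * u x))
    - (\<Sum>x\<in>UNIV. \<Sum>y\<in>UNIV. \<omega> x y * u x * u y) / 2"

lemma mu_nonzero [simp]: "\<mu> x \<noteq> 0"
  using measure_pos[of x] by simp

lemma deg_nonneg: "deg x \<ge> 0"
  unfolding deg_def using measure_pos[of x] by (intro divide_nonneg_pos sum_nonneg weight_nonneg)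

lemma laplacian_eq: "graph_laplacian E \<omega> \<mu> u x = (\<Sum>y\<in>UNIV. \<omega> x y * u y) / \<mu> x - deg x * u x"
proof -
  have "\<omega> x y = 0" if "\<not> E x y" for y
    using that weight_pos_iff[of x y] weight_nonneg[of x y] by simp
  then have "(\<Sum>y\<in>{y. E x y}. \<omega> x y * (u y - u x)) = (\<Sum>y\<in>UNIV. \<omega> x y * (u y - u x))"
    by (intro sum.mono_neutral_left) auto
  also have "\<dots> = (\<Sum>y\<in>UNIV. \<omega> x y * u y) - (\<Sum>y\<in>UNIV. \<omega> x y) * u x"
    by (simp add: right_diff_distrib sum_subtractf sum_distrib_right)
  finally show ?thesis
    by (simp add: graph_laplacian_def deg_def diff_divide_distrib)
qed

lemma F_minus_c: "F u x - c = R u x - \<Phi> x (u x)"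
proof -
  have "h\<^sub>p x = max 0 (h\<^sub>p x) - max 0 (- h\<^sub>p x)"
    by simp
  then have "h\<^sub>p x * exp (u x) = max 0 (h\<^sub>p x) * exp (u x) - max 0 (- h\<^sub>p x) * exp (u x)"
    by (metis left_diff_distrib)
  then show ?thesis
    by (simp add: F_def laplacian_eq R_def \<Phi>_def algebra_simps)
qed

text \<open>All three terms are nondecreasing and the first has slope \<open>1 + deg x\<close>.
  Injectivity, surjectivity and the Lipschitz bound for the inverse all follow from this
  estimate.\<close>

lemma \<Phi>_expanding:
  assumes "s \<le> t"
  shows "t - s \<le> \<Phi> x t - \<Phi> x s"
proof -
  have 1: "(1 + deg x) * (t - s) \<ge> 1 * (t - s)"
    using deg_nonneg[of x] assms by (intro mult_right_mono) auto
  have 2: "max 0 (- h\<^sub>p x) * (exp t - exp s) \<ge> 0"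
    using assms by (intro mult_nonneg_nonneg) auto
  have 3: "h\<^sub>m x * (exp (- s) - exp (- t)) \<ge> 0"
    using assms hm_nonneg[of x] by (intro mult_nonneg_nonneg) auto
  show ?thesis
    using 1 2 3 by (simp add: \<Phi>_def algebra_simps)
qed

lemma \<Phi>_le_iff: "\<Phi> x s \<le> \<Phi> x t \<longleftrightarrow> s \<le> t"
  using \<Phi>_expanding[of s t x] \<Phi>_expanding[of t s x] by linarith

lemma \<Phi>_bij: "bij (\<Phi> x)"
proof (rule bijI)
  show "inj (\<Phi> x)"
    by (rule injI) (metis \<Phi>_le_iff order_antisym order_refl)
  show "surj (\<Phi> x)"
    unfolding surj_def
  proof
    fix r
    define d where "d = \<bar>r - \<Phi> x 0\<bar>"
    have "\<Phi> x (- d) \<le> r" "r \<le> \<Phi> x d"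
      using \<Phi>_expanding[of "- d" 0 x] \<Phi>_expanding[of 0 d x] unfolding d_def by linarith+
    moreover have "continuous_on {- d..d} (\<Phi> x)"
      unfolding \<Phi>_def[abs_def] by (intro continuous_intros)
    ultimately show "\<exists>s. r = \<Phi> x s"
      using IVT'[of "\<Phi> x" "- d" r d] unfolding d_def by auto
  qed
qed

lemma \<Phi>_T [simp]: "\<Phi> x (T u x) = R u x"
  by (simp add: T_def \<Phi>_bij bij_is_surj surj_f_inv_f)

lemma T_le_iff: "T u x \<le> s \<longleftrightarrow> R u x \<le> \<Phi> x s" and le_T_iff: "s \<le> T u x \<longleftrightarrow> \<Phi> x s \<le> R u x"
  by (metis \<Phi>_T \<Phi>_le_iff)+

lemma T_less_iff: "T u x < u x \<longleftrightarrow> F u x < c"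
  using le_T_iff[of "u x" u x] F_minus_c[of u x] by linarith

lemma T_le_self_iff: "T u \<le> u \<longleftrightarrow> (\<forall>x. F u x \<le> c)"
proof -
  have "T u x \<le> u x \<longleftrightarrow> F u x \<le> c" for x
    using T_le_iff[of u x "u x"] F_minus_c[of u x] by linarith
  then show ?thesis
    by (simp add: le_fun_def)
qed

lemma self_le_T_iff: "u \<le> T u \<longleftrightarrow> (\<forall>x. c \<le> F u x)"
  using T_less_iff by (simp add: le_fun_def not_less flip: not_le)

lemma solution_iff_fixpoint: "sinh_gordon_solution E \<omega> \<mu> h\<^sub>p h\<^sub>m c u \<longleftrightarrow> T u = u"
proof -
  have "sinh_gordon_solution E \<omega> \<mu> h\<^sub>p h\<^sub>m c u \<longleftrightarrow> (\<forall>x. F u x = c)"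
    unfolding sinh_gordon_solution_def F_def by (smt (verit))
  also have "\<dots> \<longleftrightarrow> T u = u"
    using T_le_self_iff[of u] self_le_T_iff[of u] by (auto intro: antisym)
  finally show ?thesis .
qed

lemma mono_T: "mono T"
proof (rule monoI, rule le_funI)
  fix u v :: "'v \<Rightarrow> real" and x assume "u \<le> v"
  then have le: "u y \<le> v y" for y
    by (simp add: le_fun_def)
  have "R u x \<le> R v x"
    unfolding R_def using le measure_pos[of x] weight_nonneg
    by (intro diff_mono add_mono divide_right_mono sum_mono mult_left_mono) auto
  then show "T u x \<le> T v x"
    by (simp add: T_le_iff)
qed

text \<open>The inverse of an expanding map is 1-Lipschitz, so \<open>T\<close> inherits continuity
  from \<open>R\<close>.\<close>

lemma tendsto_T:
  assumes "\<And>y. ((\<lambda>t. f t y) \<longlongrightarrow> l y) A"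
  shows "((\<lambda>t. T (f t) x) \<longlongrightarrow> T l x) A"
proof -
  have R: "((\<lambda>t. R (f t) x) \<longlongrightarrow> R l x) A"
    unfolding R_def by (intro tendsto_intros assms) simp
  have "\<bar>T u x - T v x\<bar> \<le> \<bar>R u x - R v x\<bar>" for u v
    using \<Phi>_expanding[of "T u x" "T v x" x] \<Phi>_expanding[of "T v x" "T u x" x]
    by (cases "T u x \<le> T v x") auto
  then have "\<forall>\<^sub>F t in A. norm (T (f t) x - T l x) \<le> \<bar>R (f t) x - R l x\<bar>"
    by simp
  from Lim_null_comparison[OF this tendsto_rabs_zero[OF LIM_zero[OF R]]]
  show ?thesis
    by (rule LIM_zero_cancel)
qed

lemma tendsto_funpow_T:
  assumes "\<And>y. ((\<lambda>t. f t y) \<longlongrightarrow> l y) A"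
  shows "((\<lambda>t. (T ^^ k) (f t) x) \<longlongrightarrow> (T ^^ k) l x) A"
proof (induction k arbitrary: x)
  case 0
  show ?case
    by (simp add: assms)
next
  case (Suc k)
  show ?case
    using tendsto_T[OF Suc] by simp
qed

section \<open>Decrease of the energy under the iteration\<close>

text \<open>\<open>J\<close> is a difference of two convex functions, and \<open>T u\<close> linearises the second one at \<open>u\<close>, up
  to the indefinite quadratic form of \<open>\<omega>\<close>, which the degree term absorbs.\<close>

lemma J_T_le: "J (T u) \<le> J u - (\<Sum>x\<in>UNIV. \<mu> x * (T u x - u x)\<^sup>2)"
proof -
  define v where "v = T u"
  define W where "W x = v x - u x" for x
  define P where "P w x = deg x * (w x)\<^sup>2 / 2 - h\<^sub>p x * exp (w x) + h\<^sub>m x * exp (- w x) + c * w x" for w :: "'v \<Rightarrow> real" and x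
  define S where "S x = (\<Sum>y\<in>UNIV. \<omega> x y * u y)" for x
  have exp_tangent: "exp s * (t - s) \<le> exp t - exp s" for s t :: real
  proof -
    have "exp s * (1 + (t - s)) \<le> exp s * exp (t - s)"
      by (intro mult_left_mono exp_ge_add_one_self) auto
    then show ?thesis
      by (simp add: algebra_simps flip: exp_add)
  qed
  have P: "P v x - P u x \<le> W x * S x / \<mu> x - (W x)\<^sup>2 - deg x * (W x)\<^sup>2 / 2" for x
  proof -
    have "\<Phi> x (v x) = R u x"
      by (simp add: v_def)
    then have eq: "(1 + deg x) * v x + max 0 (- h\<^sub>p x) * exp (v x) - h\<^sub>m x * exp (- v x)
        = u x + S x / \<mu> x + max 0 (h\<^sub>p x) * exp (u x) - c"
      by (simp add: \<Phi>_def R_def S_def)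
    \<comment> \<open>Tangents of \<open>exp\<close> are taken at the old value for the term in
      \<open>R\<close> and at the new value for the terms in \<open>\<Phi>\<close>, so that exactly
      the terms of \<open>eq\<close> appear.\<close>
    have 1: "max 0 (h\<^sub>p x) * (exp (u x) * W x) \<le> max 0 (h\<^sub>p x) * (exp (v x) - exp (u x))"
      unfolding W_def by (intro mult_left_mono exp_tangent) auto
    have 2: "max 0 (- h\<^sub>p x) * (exp (v x) * (- W x)) \<le> max 0 (- h\<^sub>p x) * (exp (u x) - exp (v x))"
      using exp_tangent[of "v x" "u x"] unfolding W_def by (intro mult_left_mono) auto
    have 3: "h\<^sub>m x * (exp (- v x) * W x) \<le> h\<^sub>m x * (exp (- u x) - exp (- v x))"
      using exp_tangent[of "- v x" "- u x"] hm_nonneg unfolding W_def by (intro mult_left_mono) auto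
    have h: "h\<^sub>p x * z = max 0 (h\<^sub>p x) * z - max 0 (- h\<^sub>p x) * z" for z
      by (simp add: max_def)
    have "P v x - P u x = deg x * ((v x)\<^sup>2 - (u x)\<^sup>2) / 2 - max 0 (h\<^sub>p x) * (exp (v x) - exp (u x))
        - max 0 (- h\<^sub>p x) * (exp (u x) - exp (v x)) - h\<^sub>m x * (exp (- u x) - exp (- v x)) + c * W x"
      unfolding P_def W_def h by (simp add: algebra_simps diff_divide_distrib)
    also have "\<dots> \<le> deg x * ((v x)\<^sup>2 - (u x)\<^sup>2) / 2 - max 0 (h\<^sub>p x) * (exp (u x) * W x)
        - max 0 (- h\<^sub>p x) * (exp (v x) * (- W x)) - h\<^sub>m x * (exp (- v x) * W x) + c * W x"
      using 1 2 3 by linarith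
    also have "\<dots> = deg x * ((v x)\<^sup>2 - (u x)\<^sup>2) / 2 + W x * (max 0 (- h\<^sub>p x) * exp (v x) - h\<^sub>m x * exp (- v x)
        - max 0 (h\<^sub>p x) * exp (u x) + c)"
      by (simp add: algebra_simps)
    also have "max 0 (- h\<^sub>p x) * exp (v x) - h\<^sub>m x * exp (- v x) - max 0 (h\<^sub>p x) * exp (u x) + c
        = S x / \<mu> x - W x - deg x * v x"
      using eq unfolding W_def by (simp add: algebra_simps)
    also have "deg x * ((v x)\<^sup>2 - (u x)\<^sup>2) / 2 + W x * (S x / \<mu> x - W x - deg x * v x)
        = W x * S x / \<mu> x - (W x)\<^sup>2 - deg x * (W x)\<^sup>2 / 2"
      unfolding W_def by (simp add: field_simps power2_eq_square)
    finally show ?thesis .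
  qed
  have A: "(\<Sum>x\<in>UNIV. \<mu> x * P v x) - (\<Sum>x\<in>UNIV. \<mu> x * P u x)
      \<le> (\<Sum>x\<in>UNIV. W x * S x) - (\<Sum>x\<in>UNIV. \<mu> x * (W x)\<^sup>2) - (\<Sum>x\<in>UNIV. \<mu> x * deg x * (W x)\<^sup>2) / 2"
  proof -
    have "(\<Sum>x\<in>UNIV. \<mu> x * P v x) - (\<Sum>x\<in>UNIV. \<mu> x * P u x) = (\<Sum>x\<in>UNIV. \<mu> x * (P v x - P u x))"
      by (simp add: right_diff_distrib sum_subtractf)
    also have "\<dots> \<le> (\<Sum>x\<in>UNIV. \<mu> x * (W x * S x / \<mu> x - (W x)\<^sup>2 - deg x * (W x)\<^sup>2 / 2))"
      by (intro sum_mono mult_left_mono P less_imp_le measure_pos)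
    also have "\<dots> = (\<Sum>x\<in>UNIV. W x * S x) - (\<Sum>x\<in>UNIV. \<mu> x * (W x)\<^sup>2) - (\<Sum>x\<in>UNIV. \<mu> x * deg x * (W x)\<^sup>2) / 2"
      by (simp add: right_diff_distrib sum_subtractf sum_divide_distrib mult.assoc)
    finally show ?thesis .
  qed
  have swap: "(\<Sum>x\<in>UNIV. \<Sum>y\<in>UNIV. \<omega> x y * f y x) = (\<Sum>x\<in>UNIV. \<Sum>y\<in>UNIV. \<omega> x y * f x y)" for f :: "'v \<Rightarrow> 'v \<Rightarrow> real"
    by (subst sum.swap) (simp add: weight_sym)
  have WS: "(\<Sum>x\<in>UNIV. W x * S x) = (\<Sum>x\<in>UNIV. \<Sum>y\<in>UNIV. \<omega> x y * (W x * u y))"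
    by (simp add: S_def sum_distrib_left mult.left_commute)
  have B: "(\<Sum>x\<in>UNIV. \<Sum>y\<in>UNIV. \<omega> x y * v x * v y) - (\<Sum>x\<in>UNIV. \<Sum>y\<in>UNIV. \<omega> x y * u x * u y)
      = (\<Sum>x\<in>UNIV. \<Sum>y\<in>UNIV. \<omega> x y * (W x * W y)) + 2 * (\<Sum>x\<in>UNIV. W x * S x)"
  proof -
    have "\<omega> x y * v x * v y - \<omega> x y * u x * u y
        = \<omega> x y * (W x * W y) + \<omega> x y * (W x * u y) + \<omega> x y * (W y * u x)" for x y
      by (simp add: W_def algebra_simps)
    then have "(\<Sum>x\<in>UNIV. \<Sum>y\<in>UNIV. \<omega> x y * v x * v y) - (\<Sum>x\<in>UNIV. \<Sum>y\<in>UNIV. \<omega> x y * u x * u y)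
      = (\<Sum>x\<in>UNIV. \<Sum>y\<in>UNIV. \<omega> x y * (W x * W y)) + (\<Sum>x\<in>UNIV. \<Sum>y\<in>UNIV. \<omega> x y * (W x * u y))
        + (\<Sum>x\<in>UNIV. \<Sum>y\<in>UNIV. \<omega> x y * (W y * u x))"
      by (simp flip: sum_subtractf add: sum.distrib)
    then show ?thesis
      using swap[of "\<lambda>x y. W x * u y"] WS by simp
  qed
  \<comment> \<open>The squares are of sums, not differences, because the quadratic form of
    \<open>\<omega>\<close> enters \<open>J\<close> with a minus sign.\<close>
  have C: "0 \<le> (\<Sum>x\<in>UNIV. \<mu> x * deg x * (W x)\<^sup>2) + (\<Sum>x\<in>UNIV. \<Sum>y\<in>UNIV. \<omega> x y * (W x * W y))"
  proof -
    have "0 \<le> (\<Sum>x\<in>UNIV. \<Sum>y\<in>UNIV. \<omega> x y * (W x + W y)\<^sup>2)"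
      by (intro sum_nonneg mult_nonneg_nonneg weight_nonneg) auto
    also have "\<dots> = (\<Sum>x\<in>UNIV. \<Sum>y\<in>UNIV. \<omega> x y * (W x)\<^sup>2) + (\<Sum>x\<in>UNIV. \<Sum>y\<in>UNIV. \<omega> x y * (W y)\<^sup>2)
        + 2 * (\<Sum>x\<in>UNIV. \<Sum>y\<in>UNIV. \<omega> x y * (W x * W y))"
      by (simp add: power2_sum distrib_left sum.distrib sum_distrib_left mult_ac)
    also have "(\<Sum>x\<in>UNIV. \<Sum>y\<in>UNIV. \<omega> x y * (W y)\<^sup>2) = (\<Sum>x\<in>UNIV. \<Sum>y\<in>UNIV. \<omega> x y * (W x)\<^sup>2)"
      using swap[of "\<lambda>x y. (W x)\<^sup>2"] .
    also have "(\<Sum>x\<in>UNIV. \<Sum>y\<in>UNIV. \<omega> x y * (W x)\<^sup>2) = (\<Sum>x\<in>UNIV. \<mu> x * deg x * (W x)\<^sup>2)"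
      by (simp add: deg_def sum_distrib_right)
    finally show ?thesis
      by simp
  qed
  have J: "J w = (\<Sum>x\<in>UNIV. \<mu> x * P w x) - (\<Sum>x\<in>UNIV. \<Sum>y\<in>UNIV. \<omega> x y * w x * w y) / 2" for w
    by (simp add: J_def P_def)
  have "J v \<le> J u - (\<Sum>x\<in>UNIV. \<mu> x * (W x)\<^sup>2)"
    using A B C unfolding J by linarith
  then show ?thesis
    by (simp add: W_def v_def)
qed

lemma J_T_eq_imp_fixpoint:
  assumes "J u \<le> J (T u)"
  shows "T u = u"
proof -
  have "(\<Sum>x\<in>UNIV. \<mu> x * (T u x - u x)\<^sup>2) \<le> 0"
    using J_T_le[of u] assms by simp
  moreover have nn: "0 \<le> \<mu> x * (T u x - u x)\<^sup>2" for x
    using measure_pos[of x] by simp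
  ultimately have "(\<Sum>x\<in>UNIV. \<mu> x * (T u x - u x)\<^sup>2) = 0"
    by (intro antisym sum_nonneg) auto
  then have "\<forall>x. \<mu> x * (T u x - u x)\<^sup>2 = 0"
    using nn by (simp add: sum_nonneg_eq_0_iff)
  then show ?thesis
    by (auto simp: fun_eq_iff)
qed

lemma tendsto_J:
  assumes "\<And>y. ((\<lambda>t. f t y) \<longlongrightarrow> l y) A"
  shows "((\<lambda>t. J (f t)) \<longlongrightarrow> J l) A"
  unfolding J_def by (intro tendsto_intros assms) simp_all

section \<open>A priori bounds and the solution below a supersolution\<close>

text \<open>Induction along a path from \<open>a\<close>: since all values are at least
  \<open>\<sigma>\<close>, a bound on the weighted sum at \<open>x\<close> bounds the value at each
  neighbour of \<open>x\<close>. It serves both the supersolutions and the threshold orbit.\<close>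

lemma bounded_by_chain:
  fixes U :: "('v \<Rightarrow> real) set"
  assumes low: "\<And>u y. u \<in> U \<Longrightarrow> \<sigma> \<le> u y"
    and base: "\<And>u. u \<in> U \<Longrightarrow> u a \<le> b"
    and step: "\<And>x B. (\<And>u. u \<in> U \<Longrightarrow> u x \<le> B) \<Longrightarrow> \<exists>C. \<forall>u\<in>U. (\<Sum>y\<in>UNIV. \<omega> x y * u y) \<le> C"
  shows "\<exists>B. \<forall>u\<in>U. \<forall>x. u x \<le> B"
proof -
  have "\<exists>B. \<forall>u\<in>U. u x \<le> B" for x
    using connected[of a x]
  proof (induction rule: rtranclp_induct)
    case base
    then show ?case
      using assms(2) by blast
  next
    case (step x y)
    then obtain C where C: "\<And>u. u \<in> U \<Longrightarrow> (\<Sum>z\<in>UNIV. \<omega> x z * u z) \<le> C"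
      using assms(3)[of x] by blast
    have pos: "\<omega> x y > 0"
      using step weight_pos_iff by simp
    show ?case
    proof (intro exI ballI)
      fix u assume u: "u \<in> U"
      have "\<omega> x y * (u y - \<sigma>) \<le> (\<Sum>z\<in>UNIV. \<omega> x z * (u z - \<sigma>))"
        using low[OF u] weight_nonneg by (intro member_le_sum) auto
      also have "\<dots> \<le> C - (\<Sum>z\<in>UNIV. \<omega> x z * \<sigma>)"
        using C[OF u] by (simp add: right_diff_distrib sum_subtractf)
      finally show "u y \<le> (C - (\<Sum>z\<in>UNIV. \<omega> x z * \<sigma>)) / \<omega> x y + \<sigma>"
        using pos by (simp add: field_simps)
    qed
  qed
  then obtain B where B: "\<And>x u. u \<in> U \<Longrightarrow> u x \<le> B x"
    by metis
  have "u x \<le> Max (range B)" if "u \<in> U" for u x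
    using B[OF that, of x] by (rule order_trans) simp
  then show ?thesis
    by blast
qed

text \<open>Chosen so that \<open>exp \<sigma>\<close> times a strict upper bound of every
  \<open>\<bar>h\<^sub>p x\<bar>\<close> equals \<open>- c\<close>; the 1 makes the bound strict and
  the denominator positive.\<close>

definition \<sigma> :: real
  where "\<sigma> = ln (- c / (1 + (\<Sum>x\<in>UNIV. \<bar>h\<^sub>p x\<bar>)))"

lemma hp_exp_sigma: "c < h\<^sub>p x * exp \<sigma>"
proof -
  let ?H = "\<Sum>x\<in>UNIV. \<bar>h\<^sub>p x\<bar>"
  have H: "\<bar>h\<^sub>p x\<bar> \<le> ?H"
    by (rule member_le_sum) auto
  then have pos: "1 + ?H > 0"
    by linarith
  then have e: "exp \<sigma> = - c / (1 + ?H)"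
    unfolding \<sigma>_def using c_neg by (intro exp_ln divide_pos_pos) auto
  have "- h\<^sub>p x * (- c) < (1 + ?H) * (- c)"
    using H c_neg by (intro mult_strict_right_mono) auto
  then show ?thesis
    using pos unfolding e by (simp add: field_simps)
qed

text \<open>Minimum principle: at a minimum \<open>z\<close> the Laplacian is nonnegative, hence
  \<open>h\<^sub>p z * exp (u z) \<le> c < 0\<close>. So \<open>h\<^sub>p z\<close> is negative, and
  comparison with \<open>hp_exp_sigma\<close> gives \<open>\<sigma> < u z\<close>.\<close>

lemma supersolution_ge:
  assumes "\<And>x. F u x \<le> c"
  shows "\<sigma> \<le> u x"
proof -
  obtain z where z: "u z \<le> u y" for y
    using ex_min_if_finite[of "range u"] by (auto simp: not_less)
  have "graph_laplacian E \<omega> \<mu> u z \<ge> 0"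
    unfolding graph_laplacian_def using measure_pos[of z] z
    by (intro mult_nonneg_nonneg sum_nonneg weight_nonneg) simp_all
  moreover have "h\<^sub>m z * exp (- u z) \<ge> 0"
    using hm_nonneg by simp
  ultimately have le: "h\<^sub>p z * exp (u z) \<le> c"
    using assms[of z] unfolding F_def by linarith
  then have "h\<^sub>p z * exp (u z) < 0"
    using c_neg by linarith
  then have "h\<^sub>p z < 0"
    by (simp add: mult_less_0_iff)
  moreover have "h\<^sub>p z * exp (u z) < h\<^sub>p z * exp \<sigma>"
    using le hp_exp_sigma[of z] by linarith
  ultimately have "\<sigma> < u z"
    by (simp add: mult_less_cancel_left)
  with z[of x] show ?thesis
    by linarith
qed

text \<open>If \<open>u a = b\<close> is this large and all values are at least
  \<open>\<sigma>\<close>, then \<open>F u a > 0\<close>, so \<open>u\<close> is no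
  supersolution.\<close>

lemma exp_dominates: "\<exists>b0. \<forall>b\<ge>b0. deg a * (b - \<sigma>) < h\<^sub>p a * exp b"
proof (intro exI allI impI)
  \<comment> \<open>The threshold makes \<open>deg a * (b - \<sigma>)\<close> at most
    \<open>h\<^sub>p a * (b\<^sup>2 / 2)\<close>, which the exponential beats.\<close>
  fix b assume b: "b \<ge> max 1 (2 * deg a * (1 + \<bar>\<sigma>\<bar>) / h\<^sub>p a)"
  then have b1: "b \<ge> 1" and b2: "2 * deg a * (1 + \<bar>\<sigma>\<bar>) \<le> h\<^sub>p a * b"
    using hp_pos by (auto simp: field_simps)
  have "1 * \<bar>\<sigma>\<bar> \<le> b * \<bar>\<sigma>\<bar>"
    using b1 by (intro mult_right_mono) auto
  then have "deg a * (b - \<sigma>) \<le> deg a * ((1 + \<bar>\<sigma>\<bar>) * b)"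
    using deg_nonneg[of a] by (intro mult_left_mono) (auto simp: algebra_simps)
  also have "\<dots> \<le> h\<^sub>p a * (b\<^sup>2 / 2)"
    using mult_right_mono[OF b2, of b] b1 by (simp add: algebra_simps power2_eq_square)
  also have "\<dots> < h\<^sub>p a * exp b"
    using exp_lower_Taylor_quadratic[of b] b1 hp_pos by (intro mult_strict_left_mono) auto
  finally show "deg a * (b - \<sigma>) < h\<^sub>p a * exp b" .
qed

text \<open>A supersolution has its weighted neighbour sum at \<open>x\<close> bounded in terms of
  \<open>u x\<close> alone (\<open>sum_le\<close>). At \<open>a\<close> this contradicts
  \<open>exp_dominates\<close> for large \<open>u a\<close>; elsewhere it feeds the chain
  argument.\<close>

lemma supersolutions_bounded: "\<exists>B. \<forall>u. (\<forall>x. F u x \<le> c) \<longrightarrow> (\<forall>x. u x \<le> B)"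
proof -
  let ?U = "{u. \<forall>x. F u x \<le> c}"
  obtain b0 where b0: "\<And>b. b \<ge> b0 \<Longrightarrow> deg a * (b - \<sigma>) < h\<^sub>p a * exp b"
    using exp_dominates by blast
  have sum_le: "(\<Sum>y\<in>UNIV. \<omega> x y * u y) / \<mu> x \<le> deg x * u x - h\<^sub>p x * exp (u x)" if "u \<in> ?U" for u x
  proof -
    have "F u x \<le> c"
      using that by simp
    moreover have "h\<^sub>m x * exp (- u x) \<ge> 0"
      using hm_nonneg by simp
    ultimately show ?thesis
      using c_neg by (simp add: F_def laplacian_eq)
  qed
  have "\<exists>B. \<forall>u\<in>?U. \<forall>x. u x \<le> B"
  proof (rule bounded_by_chain)
    show low: "\<sigma> \<le> u y" if "u \<in> ?U" for u y
      using supersolution_ge that by simp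
    show "u a \<le> b0" if u: "u \<in> ?U" for u
    proof (rule ccontr)
      assume "\<not> u a \<le> b0"
      then have "deg a * (u a - \<sigma>) < h\<^sub>p a * exp (u a)"
        using b0[of "u a"] by simp
      moreover have "deg a * \<sigma> \<le> (\<Sum>y\<in>UNIV. \<omega> a y * u y) / \<mu> a"
        unfolding deg_def times_divide_eq_left sum_distrib_right
        using low[OF u] measure_pos[of a] weight_nonneg
        by (intro divide_right_mono sum_mono mult_left_mono) auto
      ultimately show False
        using sum_le[OF u, of a] by (simp add: algebra_simps)
    qed
    fix x B assume B: "\<And>u. u \<in> ?U \<Longrightarrow> u x \<le> B"
    show "\<exists>C. \<forall>u\<in>?U. (\<Sum>y\<in>UNIV. \<omega> x y * u y) \<le> C"
    proof (intro exI ballI)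
      fix u assume u: "u \<in> ?U"
      have "deg x * u x \<le> deg x * B"
        using B[OF u] deg_nonneg by (intro mult_left_mono)
      moreover have "- h\<^sub>p x * exp (u x) \<le> \<bar>h\<^sub>p x\<bar> * exp B"
        using B[OF u] by (intro mult_mono) auto
      ultimately have "(\<Sum>y\<in>UNIV. \<omega> x y * u y) / \<mu> x \<le> deg x * B + \<bar>h\<^sub>p x\<bar> * exp B"
        using sum_le[OF u, of x] by linarith
      then show "(\<Sum>y\<in>UNIV. \<omega> x y * u y) \<le> (deg x * B + \<bar>h\<^sub>p x\<bar> * exp B) * \<mu> x"
        using measure_pos[of x] by (simp add: pos_divide_le_eq)
    qed
  qed
  then show ?thesis
    by auto
qed

lemma const_sigma_subsolution: "(\<lambda>_. \<sigma>) \<le> T (\<lambda>_. \<sigma>)"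
  unfolding self_le_T_iff
proof
  fix x
  have "h\<^sub>m x * exp (- \<sigma>) \<ge> 0"
    using hm_nonneg by simp
  then show "c \<le> F (\<lambda>_. \<sigma>) x"
    using hp_exp_sigma[of x] by (simp add: F_def graph_laplacian_def)
qed

lemma subsolution_le_funpow:
  assumes "v \<le> T v" "v \<le> u"
  shows "v \<le> (T ^^ k) u"
proof -
  have "v \<le> (T ^^ k) v"
  proof (induction k)
    case (Suc k)
    have "T v \<le> T ((T ^^ k) v)"
      by (rule monoD[OF mono_T Suc])
    with assms(1) show ?case
      by simp
  qed simp
  also have "\<dots> \<le> (T ^^ k) u"
    by (rule funpow_mono[OF mono_T assms(2)])
  finally show ?thesis .
qed

lemma limit_of_iterates_fixpoint:
  assumes "\<And>x. (\<lambda>k. (T ^^ k) w x) \<longlonglongrightarrow> l x"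
  shows "T l = l"
proof
  fix x
  have "(\<lambda>k. (T ^^ Suc k) w x) \<longlonglongrightarrow> T l x"
    using tendsto_T[OF assms] by simp
  moreover have "(\<lambda>k. (T ^^ Suc k) w x) \<longlonglongrightarrow> l x"
    by (rule LIMSEQ_Suc[OF assms])
  ultimately show "T l x = l x"
    by (rule LIMSEQ_unique)
qed

text \<open>The iterates of \<open>T\<close> from \<open>w\<close> decrease and stay above the
  subsolution \<open>\<sigma>\<close>, so they converge pointwise, and continuity makes the limit a
  fixed point.\<close>

lemma solution_below_supersolution:
  assumes w: "\<And>x. F w x \<le> c"
  obtains u where "T u = u" "u \<le> w"
proof -
  have Tw: "T w \<le> w"
    using w by (simp add: T_le_self_iff)
  have "(T ^^ Suc k) w \<le> (T ^^ k) w" for k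
    using funpow_mono[OF mono_T Tw, of k] by (simp add: funpow_swap1)
  then have dec: "decseq (\<lambda>k. (T ^^ k) w x)" for x
    by (simp add: decseq_Suc_iff le_fun_def)
  have low: "\<sigma> \<le> (T ^^ k) w x" for k x
    using subsolution_le_funpow[OF const_sigma_subsolution, of w k] supersolution_ge[OF w]
    by (simp add: le_fun_def)
  have "\<exists>l. (\<lambda>k. (T ^^ k) w x) \<longlonglongrightarrow> l \<and> l \<le> w x" for x
    using decseq_convergent[OF dec, of \<sigma> x] low by (metis funpow_0)
  then obtain l where l: "\<And>x. (\<lambda>k. (T ^^ k) w x) \<longlonglongrightarrow> l x" "\<And>x. l x \<le> w x"
    by metis
  show thesis
    using that[of l] limit_of_iterates_fixpoint[OF l(1)] l(2) by (simp add: le_fun_def)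
qed

end

text \<open>Bolzano-Weierstrass, transferred from vectors indexed by \<open>'v\<close>.\<close>

lemma convergent_subsequence_pointwise:
  fixes f :: "nat \<Rightarrow> 'v::finite \<Rightarrow> real"
  assumes "\<And>k x. L \<le> f k x" "\<And>k x. f k x \<le> B"
  obtains r l where "strict_mono r" "\<And>x. (\<lambda>k. f (r k) x) \<longlonglongrightarrow> l x"
proof -
  have "bounded (range (\<lambda>k. \<chi> x. f k x))"
    by (rule bounded_subset[OF bounded_cbox[of "\<chi> x. L" "\<chi> x. B"]]) (auto simp: mem_box_cart assms)
  then obtain l r where r: "strict_mono r" "((\<lambda>k. \<chi> x. f k x) \<circ> r) \<longlonglongrightarrow> l"
    using bounded_imp_convergent_subsequence by blast
  have "(\<lambda>k. f (r k) x) \<longlonglongrightarrow> l $ x" for x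
    using tendsto_vec_nth[OF r(2), of x] by (simp add: o_def)
  then show thesis
    using that r(1) by blast
qed

section \<open>The second solution from the threshold orbit\<close>

context sinh_gordon
begin

text \<open>Failing to lie strictly below \<open>w\<close> is what separates this solution from the
  one obtained by decreasing iteration.\<close>

lemma second_solution:
  assumes w: "\<And>x. F w x < c"
  obtains u where "T u = u" "\<not> (\<forall>x. u x < w x)"
proof -
  have Tw: "T w x < w x" for x
    using w by (simp add: T_less_iff)
  have w_low: "\<sigma> \<le> w x" for x
    using supersolution_ge[of w x] w by (simp add: less_imp_le)
  obtain b1 where b1: "\<And>b. b \<ge> b1 \<Longrightarrow> deg a * (b - \<sigma>) < h\<^sub>p a * exp b"
    using exp_dominates by blast
  \<comment> \<open>Being at least \<open>w a\<close> keeps anything above \<open>V\<close> from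
    being below \<open>w\<close>; being at least \<open>b1\<close> makes \<open>V\<close> a
    subsolution at \<open>a\<close>.\<close>
  define b0 where "b0 = max (w a) b1"
  have b0: "w a \<le> b0" "deg a * (b0 - \<sigma>) < h\<^sub>p a * exp b0"
    using b1 by (auto simp: b0_def)
  \<comment> \<open>An orbit that once reaches the subsolution \<open>V\<close> stays above it, hence never drops below \<open>w\<close>.\<close>
  define V where "V = (\<lambda>x. if x = a then b0 else \<sigma>)"
  have V_ge: "\<sigma> \<le> V x" for x
    using b0(1) w_low[of a] by (simp add: V_def)
  have V_sub: "V \<le> T V"
    unfolding self_le_T_iff
  proof
    fix x
    have hm: "h\<^sub>m x * exp (- V x) \<ge> 0"
      using hm_nonneg by simp
    have sum: "deg x * \<sigma> \<le> (\<Sum>y\<in>UNIV. \<omega> x y * V y) / \<mu> x"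
      unfolding deg_def times_divide_eq_left sum_distrib_right
      using V_ge measure_pos[of x] weight_nonneg
      by (intro divide_right_mono sum_mono mult_left_mono) auto
    show "c \<le> F V x"
    proof (cases "x = a")
      case True
      then show ?thesis
        using hm sum b0(2) c_neg by (simp add: F_def laplacian_eq V_def algebra_simps)
    next
      case False
      then show ?thesis
        using hm sum hp_exp_sigma[of x] by (simp add: F_def laplacian_eq V_def algebra_simps)
    qed
  qed
  define p where "p t = (\<lambda>x. w x + t)" for t :: real
  have p_low: "\<sigma> \<le> (T ^^ k) (p t) x" if "t \<ge> 0" for k t x
  proof -
    have "(\<lambda>_. \<sigma>) \<le> p t"
      using w_low that by (auto simp: p_def le_fun_def intro: add_increasing2)
    then show ?thesis
      using subsolution_le_funpow[OF const_sigma_subsolution] by (simp add: le_fun_def)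
  qed
  define D where "D = {t. t \<ge> 0 \<and> (\<exists>k. \<forall>x. (T ^^ k) (p t) x < w x)}"
  \<comment> \<open>Once strictly below \<open>w\<close>, an orbit remains so, by monotonicity and
    \<open>T w < w\<close>.\<close>
  have stay: "(T ^^ (j + k)) u x < w x" if "\<forall>x. (T ^^ k) u x < w x" for j k u x
    using that
  proof (induction j arbitrary: x)
    case (Suc j)
    then have "(T ^^ (j + k)) u \<le> w"
      by (simp add: le_fun_def less_imp_le)
    then have "T ((T ^^ (j + k)) u) x \<le> T w x"
      using monoD[OF mono_T] by (simp add: le_fun_def)
    with Tw[of x] show ?case
      by simp
  qed simp
  \<comment> \<open>An orbit reaching \<open>b0\<close> at \<open>a\<close> would stay above
    \<open>V\<close> forever, while for \<open>t\<close> in \<open>D\<close> it must be below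
    \<open>w\<close> at time \<open>m + k\<close>.\<close>
  have D_bound: "(T ^^ k) (p t) a < b0" if t: "t \<in> D" for t k
  proof (rule ccontr)
    assume "\<not> (T ^^ k) (p t) a < b0"
    then have "V \<le> (T ^^ k) (p t)"
      using p_low t by (auto simp: V_def le_fun_def D_def)
    from subsolution_le_funpow[OF V_sub this]
    have ge: "V \<le> (T ^^ (j + k)) (p t)" for j
      by (simp add: funpow_add)
    obtain m where m: "\<forall>x. (T ^^ m) (p t) x < w x"
      using t by (auto simp: D_def)
    have "(T ^^ (m + k)) (p t) a < w a"
      using stay[OF m, of k a] by (simp add: add.commute)
    moreover have "b0 \<le> (T ^^ (m + k)) (p t) a"
      using ge[of m] by (auto simp: le_fun_def V_def dest: spec[of _ a])
    ultimately show False
      using b0(1) by linarith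
  qed
  have p_cont: "((\<lambda>t. (T ^^ k) (p t) x) \<longlongrightarrow> (T ^^ k) (p s) x) (at s within A)" for k s x A
    unfolding p_def by (intro tendsto_funpow_T tendsto_intros)
  have "0 \<in> D"
    using Tw by (auto simp: D_def p_def intro!: exI[of _ "1::nat"])
  \<comment> \<open>For \<open>k = 0\<close> the bound reads \<open>w a + t < b0\<close>.\<close>
  have "bdd_above D"
    using D_bound[of _ 0] by (intro bdd_aboveI[of _ "b0 - w a"]) (force simp: p_def)
  define s where "s = Sup D"
  have s0: "s \<ge> 0"
    unfolding s_def using \<open>0 \<in> D\<close> \<open>bdd_above D\<close> by (rule cSup_upper)
  \<comment> \<open>Lying strictly below \<open>w\<close> after \<open>k\<close> steps is an open
    condition on the shift, as there are finitely many vertices; it would persist slightly to the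
    right of \<open>s = Sup D\<close>.\<close>
  have escape: "\<exists>x. w x \<le> (T ^^ k) (p s) x" for k
  proof (rule ccontr)
    assume "\<not> ?thesis"
    then have "\<forall>x. (T ^^ k) (p s) x < w x"
      by (simp add: not_le)
    then have "\<forall>x. \<forall>\<^sub>F t in at_right s. (T ^^ k) (p t) x < w x"
      using order_tendstoD(2)[OF p_cont] by blast
    then have "\<forall>\<^sub>F t in at_right s. \<forall>x. (T ^^ k) (p t) x < w x"
      by (simp add: eventually_all_finite)
    moreover have "\<forall>\<^sub>F t in at_right s. s < t"
      by (simp add: eventually_at_right_less)
    ultimately have "\<forall>\<^sub>F t in at_right s. s < t \<and> (\<forall>x. (T ^^ k) (p t) x < w x)"
      by eventually_elim auto
    then obtain t where "s < t" "\<forall>x. (T ^^ k) (p t) x < w x"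
      using eventually_happens'[OF trivial_limit_at_right_real] by blast
    then have "t \<in> D" "s < t"
      using s0 by (auto simp: D_def)
    then show False
      using cSup_upper[OF _ \<open>bdd_above D\<close>, of t] by (simp add: s_def)
  qed
  \<comment> \<open>By \<open>escape\<close>, \<open>s\<close> is not in \<open>D\<close>, so the
    bound at \<open>a\<close> has to be carried over to \<open>s\<close> by a sequence in
    \<open>D\<close>.\<close>
  have "\<exists>t. \<forall>n. t n \<in> D \<and> s - 1 / real (Suc n) < t n"
  proof -
    have "\<exists>t\<in>D. s - 1 / real (Suc n) < t" for n
    proof (rule less_cSupE)
      show "s - 1 / real (Suc n) < Sup D"
        by (simp add: s_def)
    qed (use \<open>0 \<in> D\<close> in auto)
    then show ?thesis
      by metis
  qed
  then obtain t where t: "\<And>n. t n \<in> D" "\<And>n. s - 1 / real (Suc n) < t n"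
    by blast
  have "t \<longlonglongrightarrow> s"
  proof (rule tendsto_sandwich)
    show "(\<lambda>n. s - 1 / real (Suc n)) \<longlonglongrightarrow> s"
      using tendsto_diff[OF tendsto_const[of s] lim_inverse_n'[THEN LIMSEQ_Suc]] by simp
    show "\<forall>\<^sub>F n in sequentially. t n \<le> s"
      unfolding s_def using t(1) \<open>bdd_above D\<close> by (simp add: cSup_upper)
  qed (use t in \<open>auto simp: less_imp_le\<close>)
  then have "(\<lambda>n. (T ^^ k) (p (t n)) a) \<longlonglongrightarrow> (T ^^ k) (p s) a" for k
    unfolding p_def by (intro tendsto_funpow_T tendsto_intros)
  then have a_bound: "(T ^^ k) (p s) a \<le> b0" for k
    by (rule LIMSEQ_le_const2) (use D_bound t(1) in \<open>auto simp: less_imp_le\<close>)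
  define v where "v k = (T ^^ k) (p s)" for k
  have v_Suc: "v (Suc k) = T (v k)" for k
    by (simp add: v_def)
  have v_low: "\<sigma> \<le> v k x" for k x
    using p_low[OF s0] by (simp add: v_def)
  \<comment> \<open>A bound at \<open>x\<close> for all orbit members applies to the successor
    \<open>T u\<close>, and so bounds \<open>R u x\<close> and with it the neighbour sum of
    \<open>u\<close>.\<close>
  have "\<exists>B. \<forall>u\<in>range v. \<forall>x. u x \<le> B"
  proof (rule bounded_by_chain)
    fix x B assume B: "\<And>u. u \<in> range v \<Longrightarrow> u x \<le> B"
    show "\<exists>C. \<forall>u\<in>range v. (\<Sum>y\<in>UNIV. \<omega> x y * u y) \<le> C"
    proof (intro exI ballI)
      fix u assume "u \<in> range v"
      then obtain k where u: "u = v k"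
        by blast
      have "v (Suc k) x \<le> B"
        by (rule B) simp
      then have "R u x \<le> \<Phi> x B"
        by (simp only: v_Suc T_le_iff u)
      moreover have "max 0 (h\<^sub>p x) * exp (u x) \<ge> 0"
        by simp
      ultimately have "(\<Sum>y\<in>UNIV. \<omega> x y * u y) / \<mu> x \<le> \<Phi> x B - \<sigma>"
        using v_low[of k x] c_neg unfolding R_def u by linarith
      then show "(\<Sum>y\<in>UNIV. \<omega> x y * u y) \<le> (\<Phi> x B - \<sigma>) * \<mu> x"
        using measure_pos[of x] by (simp add: pos_divide_le_eq)
    qed
  qed (use v_low a_bound in \<open>auto simp: v_def\<close>)
  then obtain B where "\<And>k x. v k x \<le> B"
    by blast
  then obtain r q where r: "strict_mono r" and q: "\<And>x. (\<lambda>k. v (r k) x) \<longlonglongrightarrow> q x"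
    using convergent_subsequence_pointwise[of \<sigma> v B] v_low by blast
  have J_dec: "J (T u) \<le> J u" for u
  proof -
    have "0 \<le> (\<Sum>x\<in>UNIV. \<mu> x * (T u x - u x)\<^sup>2)"
      using measure_pos by (intro sum_nonneg mult_nonneg_nonneg) (auto simp: less_imp_le)
    then show ?thesis
      using J_T_le[of u] by linarith
  qed
  then have "decseq (\<lambda>k. J (v k))"
    by (simp add: decseq_Suc_iff v_Suc)
  \<comment> \<open>Since \<open>r (Suc k)\<close> is at least \<open>Suc (r k)\<close>, the
    decreasing energy can be compared with one application of \<open>T\<close>; in the limit
    \<open>T\<close> does not lower the energy of \<open>q\<close>.\<close>
  then have "J (v (r (Suc k))) \<le> J (T (v (r k)))" for k
    using r by (simp add: decseq_def Suc_leI strict_mono_Suc_iff flip: v_Suc)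
  moreover have "(\<lambda>k. J (v (r (Suc k)))) \<longlonglongrightarrow> J q"
    by (rule LIMSEQ_Suc[OF tendsto_J[OF q]])
  moreover have "(\<lambda>k. J (T (v (r k)))) \<longlonglongrightarrow> J (T q)"
    by (rule tendsto_J[OF tendsto_T[OF q]])
  ultimately have "J q \<le> J (T q)"
    by (intro LIMSEQ_le) auto
  then have "T q = q"
    by (rule J_T_eq_imp_fixpoint)
  moreover have "\<not> (\<forall>x. q x < w x)"
  proof
    assume "\<forall>x. q x < w x"
    then have "\<forall>x. \<forall>\<^sub>F k in sequentially. v (r k) x < w x"
      using order_tendstoD(2)[OF q] by blast
    then have "\<forall>\<^sub>F k in sequentially. \<forall>x. v (r k) x < w x"
      by (simp add: eventually_all_finite)
    then obtain k where "\<forall>x. v (r k) x < w x"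
      using eventually_happens'[OF sequentially_bot] by blast
    then show False
      using escape[of "r k"] by (auto simp: v_def not_le[symmetric])
  qed
  ultimately show thesis
    by (rule that)
qed

text \<open>The solution \<open>u\<close> under \<open>w\<close> satisfies
  \<open>u = T u \<le> T w < w\<close>, so it differs from the second one.\<close>

lemma two_solutions:
  assumes "\<And>x. F w x < c"
  shows "\<exists>u v. u \<noteq> v \<and> T u = u \<and> T v = v"
proof -
  obtain u where u: "T u = u" "u \<le> w"
    using solution_below_supersolution[of w] assms by (auto simp: less_imp_le)
  have "u x < w x" for x
  proof -
    have "T u x \<le> T w x"
      using monoD[OF mono_T u(2)] by (simp add: le_fun_def)
    also have "\<dots> < w x"
      using assms by (simp add: T_less_iff)
    finally show ?thesis
      by (simp add: u)
  qed
  moreover obtain v where "T v = v" "\<not> (\<forall>x. v x < w x)"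
    using second_solution[OF assms] by blast
  ultimately show ?thesis
    using u(1) by metis
qed

lemma tendsto_F:
  assumes "\<And>y. ((\<lambda>t. f t y) \<longlongrightarrow> l y) A"
  shows "((\<lambda>t. F (f t) x) \<longlongrightarrow> F l x) A"
  unfolding F_def laplacian_eq by (intro tendsto_intros assms) simp

end

section \<open>Attainment of the infimum and the three ranges of \<open>c\<close>\<close>

theorem theorem2p4:
  fixes E :: "'v::finite \<Rightarrow> 'v \<Rightarrow> bool"
    and \<omega> :: "'v \<Rightarrow> 'v \<Rightarrow> real"
    and \<mu> h\<^sub>p h\<^sub>m :: "'v \<Rightarrow> real"
  assumes "finite_connected_weighted_graph E \<omega> \<mu>"
    and "(MAX x. h\<^sub>p x) > 0"
    and "\<forall>x. h\<^sub>m x \<ge> 0"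
    and "graph_integral \<mu> h\<^sub>p < 0"
    and "c_star E \<omega> \<mu> h\<^sub>p h\<^sub>m < 0"
  shows "(\<forall>c < c_star E \<omega> \<mu> h\<^sub>p h\<^sub>m. \<not> (\<exists>u. sinh_gordon_solution E \<omega> \<mu> h\<^sub>p h\<^sub>m c u))
    \<and> (\<exists>u. sinh_gordon_solution E \<omega> \<mu> h\<^sub>p h\<^sub>m (c_star E \<omega> \<mu> h\<^sub>p h\<^sub>m) u)
    \<and> (\<forall>c. c_star E \<omega> \<mu> h\<^sub>p h\<^sub>m < c \<and> c < 0 \<longrightarrow>
          (\<exists>u v. u \<noteq> v \<and> sinh_gordon_solution E \<omega> \<mu> h\<^sub>p h\<^sub>m c u
            \<and> sinh_gordon_solution E \<omega> \<mu> h\<^sub>p h\<^sub>m c v))"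
proof -
  interpret finite_connected_weighted_graph E \<omega> \<mu>
    by fact
  have "Max (range h\<^sub>p) \<in> range h\<^sub>p"
    by (intro Max_in) auto
  then obtain a where "Max (range h\<^sub>p) = h\<^sub>p a"
    by blast
  with assms(2) have a: "h\<^sub>p a > 0"
    by simp
  define F where "F u x = graph_laplacian E \<omega> \<mu> u x + h\<^sub>p x * exp (u x) + h\<^sub>m x * exp (- u x)" for u x
  let ?c = "c_star E \<omega> \<mu> h\<^sub>p h\<^sub>m"
  have c_star: "?c = Inf (range (\<lambda>u. Max (range (F u))))"
    by (simp add: c_star_def F_def)
  have bdd: "bdd_below (range (\<lambda>u. Max (range (F u))))"
    using bdd_below_c_star[OF assms(2), of h\<^sub>m] assms(3) by (simp add: F_def)
  have sinh_gordon: "sinh_gordon E \<omega> \<mu> h\<^sub>p h\<^sub>m a c" if "c < 0" for c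
    using a assms(3) that by unfold_locales auto
  have strict: "\<exists>w. \<forall>x. F w x < c" if "?c < c" for c
    using that cInf_lessD[of "range (\<lambda>u. Max (range (F u)))" c] unfolding c_star by auto
  have "\<not> sinh_gordon_solution E \<omega> \<mu> h\<^sub>p h\<^sub>m c u" if "c < ?c" for c u
  proof
    assume "sinh_gordon_solution E \<omega> \<mu> h\<^sub>p h\<^sub>m c u"
    then have "F u x = c" for x
      unfolding sinh_gordon_solution_def F_def by (smt (verit))
    then have "Max (range (F u)) = c"
      by (simp add: image_constant_conv)
    then have "?c \<le> c"
      unfolding c_star using cInf_lower[OF _ bdd] by (metis rangeI)
    with that show False
      by simp
  qed
  moreover have "\<exists>u. sinh_gordon_solution E \<omega> \<mu> h\<^sub>p h\<^sub>m ?c u"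
  proof -
    interpret s: sinh_gordon E \<omega> \<mu> h\<^sub>p h\<^sub>m a ?c
      by (rule sinh_gordon) fact
    \<comment> \<open>The approximate minimisers need not be supersolutions for \<open>?c\<close>
      itself. They are for the larger, still negative value \<open>?c / 2\<close>, whose a priori
      bounds give compactness.\<close>
    interpret h: sinh_gordon E \<omega> \<mu> h\<^sub>p h\<^sub>m a "?c / 2"
      by (rule sinh_gordon) (use assms(5) in simp)
    have F: "s.F = F"
      by (simp add: fun_eq_iff F_def s.F_def)
    \<comment> \<open>Positive, tending to 0, and small enough that \<open>?c + \<epsilon> n\<close>
      never exceeds \<open>?c / 2\<close>.\<close>
    define \<epsilon> where "\<epsilon> n = - (?c / 2) / real (Suc n)" for n
    have \<epsilon>: "\<epsilon> n > 0" "\<epsilon> n \<le> - (?c / 2)" for n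
      using assms(5) by (auto simp: \<epsilon>_def field_simps mult_nonneg_nonpos)
    have "\<exists>f. \<forall>n x. F (f n) x < ?c + \<epsilon> n"
      using strict \<epsilon>(1) by (intro choice) simp
    then obtain f where f: "\<And>n x. F (f n) x < ?c + \<epsilon> n"
      by blast
    have half: "F (f n) x \<le> ?c / 2" for n x
      using f[of n x] \<epsilon>(2)[of n] by simp
    obtain B where "\<And>n x. f n x \<le> B"
      using h.supersolutions_bounded half unfolding F by blast
    moreover have "h.\<sigma> \<le> f n x" for n x
      using h.supersolution_ge[of "f n" x] half unfolding F by blast
    ultimately obtain r l where r: "strict_mono r" and l: "\<And>x. (\<lambda>n. f (r n) x) \<longlonglongrightarrow> l x"
      using convergent_subsequence_pointwise[of h.\<sigma> f B] by blast
    have "\<epsilon> \<longlonglongrightarrow> 0"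
      unfolding \<epsilon>_def by (rule LIMSEQ_Suc[OF lim_const_over_n])
    then have "(\<lambda>n. ?c + \<epsilon> (r n)) \<longlonglongrightarrow> ?c"
      using tendsto_add[OF tendsto_const LIMSEQ_subseq_LIMSEQ[OF _ r]] by (fastforce simp: o_def)
    moreover have "(\<lambda>n. F (f (r n)) x) \<longlonglongrightarrow> F l x" for x
      using s.tendsto_F[OF l] by (simp add: F)
    ultimately have "F l x \<le> ?c" for x
      by (rule tendsto_le[OF sequentially_bot]) (use f in \<open>auto simp: less_imp_le\<close>)
    then obtain u where "s.T u = u"
      using s.solution_below_supersolution[of l] by (auto simp: F)
    then show ?thesis
      using s.solution_iff_fixpoint by blast
  qed
  moreover have "\<exists>u v. u \<noteq> v \<and> sinh_gordon_solution E \<omega> \<mu> h\<^sub>p h\<^sub>m c u \<and> sinh_gordon_solution E \<omega> \<mu> h\<^sub>p h\<^sub>m c v"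
    if c: "?c < c" "c < 0" for c
  proof -
    interpret s: sinh_gordon E \<omega> \<mu> h\<^sub>p h\<^sub>m a c
      by (rule sinh_gordon) fact
    obtain w where "\<And>x. s.F w x < c"
      using strict[OF c(1)] unfolding F_def s.F_def by blast
    then show ?thesis
      using s.two_solutions[of w] s.solution_iff_fixpoint by metis
  qed
  ultimately show ?thesis
    by blast
qed

end
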